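(* Let $n\ge 2$ and let $f:[n]\to[n]$ be any function without fixed points (i.e. $f(i)\neq i$ for all $i\in[n]$), and let $\kappa_f$ be the associated kefalopoda digraph. Then every $n$-party single-output correlation $P_{A|S,R,X}$ that agrees with definite causal order satisfies $$\Pr[\operatorname{win}(\kappa_f)]\le 1-\frac{1}{2n}.$$ Moreover, this inequality, regarded as a linear inequality on the vectors $\bm p\in\mathbb R^{2n(n-1)}$ representing correlations, is facet-defining for the polytope $\mathcal P_n^{\text{causal}}\subseteq\mathbb R^{2n(n-1)}$.
   Context: Notation: $[n]=\{0,\dots,n-1\}$; $[n]^2_{\neq}$ is the set of ordered pairs $(s,r)\in[n]\times[n]$ with $s\neq r$; $d:=n(n-1)$. Single-output correlations: conditional probability distributions $P_{A|S,R,X}$ with probabilities $p(a|s,r,x)$, where $a,x\in\{0,1\}$ and $(s,r)\in[n]^2_{\neq}$ ($s$ is the sender, who holds the input bit $x$; $r$ is the receiver, who outputs the bit $a$). Such a correlation is represented by the vector $\bm p=(\bm p^0,\bm p^1)\in\mathbb R^{2d}$ with $\bm p^x=(p(0|s,r,x))_{(s,r)\in[n]^2_{\neq}}\in\mathbb R^d$. Definite causal order: $P_{A|S,R,X}$ agrees with definite causal order if and only if its probabilities decompose as $$p(a|s,r,x)=p_{\text{first}}(r)\,p_0(a|s,r)+(1-p_{\text{first}}(r))\,p_1(a|s,r,x),$$ where $p_{\text{first}}$ is a probability distribution on $[n]$ ($p_{\text{first}}(r)$ is the probability that the receiver $r$ is first in the causal order), and $p_0(\cdot|s,r)$, $p_1(\cdot|s,r,x)$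 are conditional probability distributions on $\{0,1\}$. $\mathcal P_n^{\text{causal}}\subseteq\mathbb R^{2d}$ is the set of vectors $\bm p$ representing such correlations (it is a convex polytope). Graphical game: for a digraph $G$ with vertex set $[n]$ and arc set $\mathcal A(G)$, a referee picks an arc $s\to r$ of $G$ and a bit $x$ uniformly at random, announces $s\to r$ to all parties and $x$ to the sender $s$; the parties win, denoted $\operatorname{win}(G)$, if the receiver $r$ outputs $x$. Thus $$\Pr[\operatorname{win}(G)]=\frac{1}{2|\mathcal A(G)|}\sum_{(i\to j)\in\mathcal A(G),\,x\in\{0,1\}}p(x|i,j,x),$$ where $p(1|i,j,x)=1-p(0|i,j,x)$. Kefalopoda digraph: for a fixed-point-free $f:[n]\to[n]$, $\kappa_f$ is the digraph with vertex set $[n]$ and arc set $\{f(i)\to i\mid i\in[n]\}$. Facet-defining: for a full-dimensional convex polytope $\mathcal P\subseteq\mathbb R^{D}$, a linear inequality $\bm v\cdot\bm x\le c$ is facet-defining if it holds for all $\bm x\in\mathcal P$ and $\dim(\mathcal P\cap\{\bm x\mid\bm v\cdot\bm x=c\})=D-1$. *)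

theory Defs
  imports
    "HOL-Probability.Probability"
    "HOL-Library.Z2"
    "HOL-Library.Cardinality"
    "Graph_Theory.Pair_Digraph"
begin

text \<open>
  The set \<open>[n]\<close> of parties is the universe of a finite type \<open>'n\<close> with \<open>n = CARD('n)\<close>;
  the class \<^class>\<open>card2\<close> says that the type is finite with at least two elements.
  Bits are elements of the type \<^typ>\<open>bit\<close>, whose only elements are \<open>0\<close> and \<open>1\<close>.
\<close>

typedef ('n :: card2) offdiag = "{(s :: 'n, r :: 'n). s \<noteq> r}"
proof -
  have "\<exists>s r :: 'n. s \<noteq> r"
  proof (rule ccontr)
    assume "\<not> ?thesis"
    then have "(UNIV :: 'n set) = {undefined}" by auto
    then have "CARD('n) = 1" by (metis card_1_singleton_iff One_nat_def)
    then show False using one_less_card[where 'a = 'n] by simp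
  qed
  then show ?thesis by auto
qed

instance offdiag :: (card2) finite
proof
  have "finite (Abs_offdiag ` {(s :: 'a, r :: 'a). s \<noteq> r})" by simp
  then show "finite (UNIV :: 'a offdiag set)"
    by (simp add: type_definition.Abs_image[OF type_definition_offdiag])
qed

definition sender :: "'n :: card2 offdiag \<Rightarrow> 'n" where
  "sender e = fst (Rep_offdiag e)"

definition receiver :: "'n :: card2 offdiag \<Rightarrow> 'n" where
  "receiver e = snd (Rep_offdiag e)"

lemma sender_neq_receiver: "sender e \<noteq> receiver e"
  using Rep_offdiag[of e] by (auto simp: sender_def receiver_def)

lemma card_offdiag: "CARD('n :: card2 offdiag) = CARD('n) * (CARD('n) - 1)"
proof -
  have "{(s :: 'n, r :: 'n). s \<noteq> r} = (SIGMA s:UNIV. UNIV - {s})" by auto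
  then show ?thesis
    by (simp add: type_definition.card[OF type_definition_offdiag] card_Diff_singleton)
qed

text \<open>
  A single-output correlation: \<open>pmf (P s r x) a\<close> is the probability \<open>p(a|s,r,x)\<close>.
  The values \<open>P s s x\<close> carry no meaning and no definition below depends on them.
\<close>

type_synonym 'n correlation = "'n \<Rightarrow> 'n \<Rightarrow> bit \<Rightarrow> bit pmf"

definition definite_causal_order :: "'n :: card2 correlation \<Rightarrow> bool" where
  "definite_causal_order P \<longleftrightarrow>
    (\<exists>(p_first :: 'n pmf) (p0 :: 'n \<Rightarrow> 'n \<Rightarrow> bit pmf) (p1 :: 'n \<Rightarrow> 'n \<Rightarrow> bit \<Rightarrow> bit pmf).
      \<forall>s r x a. s \<noteq> r \<longrightarrow>
        pmf (P s r x) a =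
          pmf p_first r * pmf (p0 s r) a + (1 - pmf p_first r) * pmf (p1 s r x) a)"

text \<open>The vectors \<open>(p\<^sup>0, p\<^sup>1)\<close>, in a Euclidean space of dimension \<open>2n(n-1)\<close>.\<close>

type_synonym 'n corr_space = "(real ^ 'n offdiag) \<times> (real ^ 'n offdiag)"

lemma DIM_corr_space:
  "DIM('n :: card2 corr_space) = 2 * (CARD('n) * (CARD('n) - 1))"
  by (simp add: card_offdiag)

definition corr_vec :: "'n :: card2 correlation \<Rightarrow> 'n corr_space" where
  "corr_vec P =
    ((\<chi> e. pmf (P (sender e) (receiver e) 0) 0),
     (\<chi> e. pmf (P (sender e) (receiver e) 1) 0))"

definition causal_polytope :: "'n :: card2 corr_space set" where
  "causal_polytope = corr_vec ` {P. definite_causal_order P}"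

text \<open>Used for digraphs without loops only.\<close>

definition win_prob :: "'n pair_pre_digraph \<Rightarrow> 'n :: card2 correlation \<Rightarrow> real" where
  "win_prob G P =
    1 / (2 * real (card (parcs G))) * (\<Sum>(i, j)\<in>parcs G. \<Sum>x\<in>{0, 1}. pmf (P i j x) x)"

definition kefalopoda :: "('n \<Rightarrow> 'n) \<Rightarrow> 'n :: card2 pair_pre_digraph" where
  "kefalopoda f = \<lparr> pverts = UNIV, parcs = {(f i, i) |i. i \<in> UNIV} \<rparr>"

text \<open>
  The inequality \<open>v \<bullet> x \<le> c\<close> is facet-defining for \<open>S\<close>; that \<open>S\<close> is a
  full-dimensional convex polytope is part of the notion.
\<close>

definition facet_defining :: "'a :: euclidean_space \<Rightarrow> real \<Rightarrow> 'a set \<Rightarrow> bool" where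
  "facet_defining v c S \<longleftrightarrow>
    polytope S \<and> aff_dim S = int DIM('a) \<and>
    (\<forall>x\<in>S. v \<bullet> x \<le> c) \<and>
    aff_dim (S \<inter> {x. v \<bullet> x = c}) = int DIM('a) - 1"

end

theory Submission
  imports Defs
begin

text \<open>
  Writing \<open>u\<close> and \<open>w\<close> for the two halves of a correlation vector, definite causal order means that
  some distribution \<open>q\<close> on the parties satisfies \<open>\<bar>u\<^sub>e - w\<^sub>e\<bar> \<le> 1 - q\<^sub>r\<close> for all pairs \<open>e\<close> with
  receiver \<open>r\<close>. So the causal correlations form a projection of a bounded polyhedron, and summing
  over the \<open>n\<close> arcs of the kefalopoda, which have distinct receivers, gives \<open>\<Sum>(u - w) \<le> n - 1\<close>.
  On the hyperplane of equality, the choice \<open>q\<^sub>i = 1 - (u - w)\<close> at the arc into \<open>i\<close> is normalised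
  automatically, and the remaining constraints are open near a suitable point. So the face contains
  a nonempty relatively open subset of the hyperplane.
\<close>

section \<open>Distributions on finite sets and mixtures of two bits\<close>

lemma UNIV_bit_eq: "(UNIV :: bit set) = {0, 1}"
  by (auto intro: bit_not_zero_iff[THEN iffD1])

lemma pmf_bit_sum: "pmf p (0 :: bit) + pmf p 1 = 1"
proof -
  have "(\<Sum>a\<in>(UNIV :: bit set). pmf p a) = 1"
    by (rule sum_pmf_eq_1) (simp add: UNIV_bit_eq, rule subset_UNIV)
  then show ?thesis by (simp add: UNIV_bit_eq)
qed

lemma exists_bit_pmf:
  fixes t :: real
  assumes "0 \<le> t" "t \<le> 1"
  shows "\<exists>p :: bit pmf. pmf p 0 = t"
proof -
  define g :: "bool \<Rightarrow> bit" where "g = (\<lambda>b. if b then 0 else 1)"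
  have "inj g" by (auto simp: inj_def g_def)
  then have "pmf (map_pmf g (bernoulli_pmf t)) (g True) = pmf (bernoulli_pmf t) True"
    by (rule pmf_map_inj')
  also have "\<dots> = t" using assms by simp
  finally show ?thesis unfolding g_def by auto
qed

lemma exists_pmf_finite:
  fixes q :: "'a :: finite \<Rightarrow> real"
  assumes "\<And>i. 0 \<le> q i" "sum q UNIV = 1"
  shows "\<exists>p. \<forall>i. pmf p i = q i"
proof -
  have "(\<integral>\<^sup>+ i. ennreal (q i) \<partial>count_space UNIV) = 1"
    using assms by (simp add: nn_integral_count_space_finite sum_ennreal)
  then have "pmf (embed_pmf q) i = q i" for i
    using assms by (intro pmf_embed_pmf) auto
  then show ?thesis by blast
qed

lemma shared_mixture_exists:
  fixes q u w :: real
  assumes q: "0 \<le> q" "q \<le> 1" and u: "0 \<le> u" "u \<le> 1" and w: "0 \<le> w" "w \<le> 1"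
    and d: "\<bar>u - w\<bar> \<le> 1 - q"
  shows "\<exists>a b c. 0 \<le> a \<and> a \<le> 1 \<and> 0 \<le> b \<and> b \<le> 1 \<and> 0 \<le> c \<and> c \<le> 1 \<and>
    u = q * a + (1 - q) * b \<and> w = q * a + (1 - q) * c"
proof -
  \<comment> \<open>The mass \<open>q * a\<close> is shared by \<open>u\<close> and
    \<open>w\<close>; take as much of it as possible. The remainders fit into \<open>1 - q\<close>:
    if \<open>m = q\<close> because \<open>u\<close> and \<open>w\<close> are at most 1, otherwise
    because one remainder is 0 and the other is \<open>\<bar>u - w\<bar>\<close>.\<close>
  define m where "m = min q (min u w)"
  have m: "0 \<le> m" "m \<le> q" "m \<le> u" "m \<le> w" "u - m \<le> 1 - q" "w - m \<le> 1 - q"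
    using assms by (auto simp: m_def)
  \<comment> \<open>If a denominator \<open>q\<close> or \<open>1 - q\<close> vanishes, so does its
    numerator, and the quotient 0 is still a valid probability.\<close>
  have "\<exists>a. 0 \<le> a \<and> a \<le> 1 \<and> m = q * a"
    using m by (intro exI[of _ "m / q"]) (auto simp: divide_simps)
  moreover have "\<exists>b. 0 \<le> b \<and> b \<le> 1 \<and> u - m = (1 - q) * b"
    using m q by (intro exI[of _ "(u - m) / (1 - q)"]) (auto simp: divide_simps)
  moreover have "\<exists>c. 0 \<le> c \<and> c \<le> 1 \<and> w - m = (1 - q) * c"
    using m q by (intro exI[of _ "(w - m) / (1 - q)"]) (auto simp: divide_simps)
  ultimately obtain a b c where "0 \<le> a" "a \<le> 1" "m = q * a" "0 \<le> b" "b \<le> 1"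
    "u - m = (1 - q) * b" "0 \<le> c" "c \<le> 1" "w - m = (1 - q) * c" by blast
  then show ?thesis by (intro exI[of _ a] exI[of _ b] exI[of _ c]) auto
qed

section \<open>Causal correlations described by linear constraints\<close>

definition order_witness :: "'n :: card2 corr_space \<Rightarrow> real ^ ('n :: card2) \<Rightarrow> bool" where
  "order_witness x q \<longleftrightarrow> (\<forall>i. 0 \<le> q $ i) \<and> (\<Sum>i\<in>UNIV. q $ i) = 1 \<and>
    (\<forall>e. 0 \<le> fst x $ e \<and> fst x $ e \<le> 1 \<and> 0 \<le> snd x $ e \<and> snd x $ e \<le> 1 \<and>
      \<bar>fst x $ e - snd x $ e\<bar> \<le> 1 - q $ receiver e)"

lemma order_witness_le_1: "order_witness x q \<Longrightarrow> q $ i \<le> 1"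
  unfolding order_witness_def by (metis UNIV_I finite member_le_sum)

lemma Rep_offdiag_eq: "Rep_offdiag e = (sender e, receiver e)"
  by (simp add: sender_def receiver_def)

lemma sender_receiver_Abs:
  "s \<noteq> r \<Longrightarrow> sender (Abs_offdiag (s, r)) = s" "s \<noteq> r \<Longrightarrow> receiver (Abs_offdiag (s, r)) = r"
  by (simp_all add: sender_def receiver_def Abs_offdiag_inverse)

lemma corr_vec_order_witness:
  fixes P :: "'n :: card2 correlation"
  assumes "definite_causal_order P"
  shows "\<exists>q. order_witness (corr_vec P) q"
proof -
  obtain p_first p0 p1 where P: "\<And>s r x a. s \<noteq> r \<Longrightarrow>
        pmf (P s r x) a =
          pmf p_first r * pmf (p0 s r) a + (1 - pmf p_first r) * pmf (p1 s r x) a"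
    using assms unfolding definite_causal_order_def by blast
  have "\<bar>pmf (P s r 0) 0 - pmf (P s r 1) 0\<bar> \<le> 1 - pmf p_first r" if "s \<noteq> r" for s r
  proof -
    \<comment> \<open>A receiver who is first cannot depend on \<open>x\<close>, so the
      \<open>p0\<close> terms cancel.\<close>
    have "pmf (P s r 0) 0 - pmf (P s r 1) 0 =
        (1 - pmf p_first r) * (pmf (p1 s r 0) 0 - pmf (p1 s r 1) 0)"
      using that by (simp add: P algebra_simps)
    moreover have "\<bar>pmf (p1 s r 0) 0 - pmf (p1 s r 1) 0\<bar> \<le> 1"
      using pmf_le_1[of "p1 s r 0" 0] pmf_le_1[of "p1 s r 1" 0]
        pmf_nonneg[of "p1 s r 0" 0] pmf_nonneg[of "p1 s r 1" 0] by linarith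
    ultimately show ?thesis
      by (simp add: abs_mult pmf_le_1 mult_left_le)
  qed
  then have "order_witness (corr_vec P) (\<chi> i. pmf p_first i)"
    by (auto simp: order_witness_def corr_vec_def pmf_le_1 sum_pmf_eq_1 sender_neq_receiver)
  then show ?thesis by blast
qed

text \<open>Once \<open>q\<close> is fixed as the law of the first party, the pairs decouple:
  \<open>shared_mixture_exists\<close> supplies the output distributions separately for each
  pair.\<close>

lemma order_witness_in_causal_polytope:
  fixes x :: "'n :: card2 corr_space"
  assumes "order_witness x q"
  shows "x \<in> causal_polytope"
proof -
  have q: "\<And>i. 0 \<le> q $ i" "(\<Sum>i\<in>UNIV. q $ i) = 1" "\<And>i. q $ i \<le> 1"
    using assms order_witness_le_1[OF assms] by (auto simp: order_witness_def)
  then obtain pf where pf: "\<And>i. pmf pf i = q $ i"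
    using exists_pmf_finite[of "\<lambda>i. q $ i"] by auto
  have "\<exists>(p0 :: bit pmf) (p1 :: bit \<Rightarrow> bit pmf).
      fst x $ e = q $ receiver e * pmf p0 0 + (1 - q $ receiver e) * pmf (p1 0) 0 \<and>
      snd x $ e = q $ receiver e * pmf p0 0 + (1 - q $ receiver e) * pmf (p1 1) 0" for e
  proof -
    obtain a b c where abc: "0 \<le> a" "a \<le> 1" "0 \<le> b" "b \<le> 1" "0 \<le> c" "c \<le> 1"
      "fst x $ e = q $ receiver e * a + (1 - q $ receiver e) * b"
      "snd x $ e = q $ receiver e * a + (1 - q $ receiver e) * c"
      using shared_mixture_exists[of "q $ receiver e" "fst x $ e" "snd x $ e"] q assms
      unfolding order_witness_def by metis
    obtain A B C :: "bit pmf" where "pmf A 0 = a" "pmf B 0 = b" "pmf C 0 = c"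
      using exists_bit_pmf abc by metis
    then show ?thesis using abc
      by (intro exI[of _ A] exI[of _ "\<lambda>x. if x = 0 then B else C"]) auto
  qed
  then obtain p0 :: "'n offdiag \<Rightarrow> bit pmf" and p1 :: "'n offdiag \<Rightarrow> bit \<Rightarrow> bit pmf" where p:
    "\<And>e. fst x $ e = q $ receiver e * pmf (p0 e) 0 + (1 - q $ receiver e) * pmf (p1 e 0) 0"
    "\<And>e. snd x $ e = q $ receiver e * pmf (p0 e) 0 + (1 - q $ receiver e) * pmf (p1 e 1) 0"
    by metis
  \<comment> \<open>The mixture is realised as a two-stage experiment: draw the first party
    \<open>k\<close>, then use \<open>p0\<close> or \<open>p1\<close> according to whether
    \<open>k\<close> is the receiver.\<close>
  define M where "M e y =
    bind_pmf pf (\<lambda>k. if k = receiver e then p0 e else p1 e y)" for e y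
  have M: "pmf (M e y) a =
      q $ receiver e * pmf (p0 e) a + (1 - q $ receiver e) * pmf (p1 e y) a" for e y a
  proof -
    have "pmf (M e y) a = (\<Sum>k\<in>UNIV. q $ k *
        (if k = receiver e then pmf (p0 e) a else pmf (p1 e y) a))"
      unfolding M_def pmf_bind
      by (subst integral_measure_pmf_real[of UNIV]) (auto simp: pf mult.commute intro!: sum.cong)
    \<comment> \<open>Use \<open>p1\<close> for every \<open>k\<close>, so that the total mass 1
      factors out, and correct the single term \<open>k = receiver e\<close>.\<close>
    also have "\<dots> = (\<Sum>k\<in>UNIV. q $ k * pmf (p1 e y) a +
        (if k = receiver e then q $ k * (pmf (p0 e) a - pmf (p1 e y) a) else 0))"
      by (intro sum.cong) (auto simp: algebra_simps)
    also have "\<dots> = pmf (p1 e y) a + q $ receiver e * (pmf (p0 e) a - pmf (p1 e y) a)"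
      by (simp add: sum.distrib q(2) flip: sum_distrib_right)
    finally show ?thesis by (simp add: algebra_simps)
  qed
  define P :: "'n correlation" where "P s r y = M (Abs_offdiag (s, r)) y" for s r y
  have "definite_causal_order P"
    unfolding definite_causal_order_def
    by (intro exI[of _ pf] exI[of _ "\<lambda>s r. p0 (Abs_offdiag (s, r))"]
          exI[of _ "\<lambda>s r. p1 (Abs_offdiag (s, r))"])
      (simp add: P_def M pf sender_receiver_Abs)
  moreover have "corr_vec P = x"
    by (simp add: corr_vec_def P_def M p prod_eq_iff vec_eq_iff Rep_offdiag_inverse
        flip: Rep_offdiag_eq)
  ultimately show ?thesis unfolding causal_polytope_def by blast
qed

text \<open>The products of unknowns in \<open>definite_causal_order\<close> are gone:
  \<open>order_witness\<close> is jointly linear in \<open>x\<close> and \<open>q\<close>.\<close>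

lemma causal_polytope_eq:
  "(causal_polytope :: 'n :: card2 corr_space set) = {x. \<exists>q. order_witness x q}"
proof (intro set_eqI iffI)
  fix x :: "'n corr_space" assume "x \<in> causal_polytope"
  then show "x \<in> {x. \<exists>q. order_witness x q}"
    using corr_vec_order_witness unfolding causal_polytope_def by blast
qed (use order_witness_in_causal_polytope in blast)

section \<open>The causal set is a polytope\<close>

lemma polyhedron_linear_le:
  fixes g :: "'a :: euclidean_space \<Rightarrow> real"
  assumes "linear g"
  shows "polyhedron {z. g z \<le> c}"
proof -
  \<comment> \<open>The normal vector comes from the adjoint, so that later each constraint needs
    only a proof of linearity.\<close>
  have "g = (\<lambda>z. adjoint g (1 :: real) \<bullet> z)"
    using adjoint_works[OF assms, of _ 1] by (simp add: fun_eq_iff inner_commute)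
  then show ?thesis by (metis polyhedron_halfspace_le)
qed

lemma polyhedron_Collect_all:
  fixes A :: "'i :: finite \<Rightarrow> 'a :: euclidean_space \<Rightarrow> bool"
  assumes "\<And>i. polyhedron {z. A i z}"
  shows "polyhedron {z. \<forall>i. A i z}"
proof -
  have "{z. \<forall>i. A i z} = \<Inter> (range (\<lambda>i. {z. A i z}))" by auto
  then show ?thesis using assms by (auto intro!: polyhedron_Inter)
qed

lemma polyhedron_Collect_conj:
  assumes "polyhedron {z. A z}" "polyhedron {z. B z}"
  shows "polyhedron {z. A z \<and> B z}"
  using polyhedron_Int[OF assms] by (simp add: Int_def)

lemma norm_unit_cube_le:
  fixes v :: "real ^ 'i"
  assumes "\<And>i. 0 \<le> v $ i \<and> v $ i \<le> 1"
  shows "norm v \<le> real CARD('i)"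
proof -
  have "norm v \<le> (\<Sum>i\<in>UNIV. \<bar>v $ i\<bar>)" by (rule norm_le_l1_cart)
  also have "\<dots> \<le> (\<Sum>i\<in>(UNIV :: 'i set). 1)" using assms by (intro sum_mono) auto
  finally show ?thesis by simp
qed

lemma polytope_causal_polytope: "polytope (causal_polytope :: 'n :: card2 corr_space set)"
proof -
  define Q :: "('n corr_space \<times> (real, 'n) vec) set" where
    "Q = {z. order_witness (fst z) (snd z)}"
  \<comment> \<open>Equalities and absolute values are split so that every constraint has the form
    of a linear functional bounded above by a constant.\<close>
  have Q: "Q = {z.
    (\<forall>i. - (snd z $ i) \<le> 0) \<and> (\<Sum>i\<in>UNIV. snd z $ i) \<le> 1 \<and> - (\<Sum>i\<in>UNIV. snd z $ i) \<le> -1 \<and>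
    (\<forall>e. - (fst (fst z) $ e) \<le> 0 \<and> fst (fst z) $ e \<le> 1 \<and>
       - (snd (fst z) $ e) \<le> 0 \<and> snd (fst z) $ e \<le> 1 \<and>
       fst (fst z) $ e - snd (fst z) $ e + snd z $ receiver e \<le> 1 \<and>
       snd (fst z) $ e - fst (fst z) $ e + snd z $ receiver e \<le> 1)}"
    unfolding Q_def order_witness_def by (intro Collect_cong) (auto simp: abs_le_iff; smt (verit))
  have "polyhedron Q"
    unfolding Q
    by (intro polyhedron_Collect_conj polyhedron_Collect_all polyhedron_linear_le)
       (auto intro!: linearI simp: sum.distrib sum_distrib_left algebra_simps)
  moreover have "bounded Q"
  proof (rule boundedI)
    fix z assume "z \<in> Q"
    then have d: "order_witness (fst z) (snd z)" by (simp add: Q_def)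
    have "norm (fst (fst z)) \<le> real CARD('n offdiag)" "norm (snd (fst z)) \<le> real CARD('n offdiag)"
      "norm (snd z) \<le> real CARD('n)"
      using d order_witness_le_1[OF d] by (auto intro!: norm_unit_cube_le simp: order_witness_def)
    moreover have "norm z \<le> norm (fst (fst z)) + norm (snd (fst z)) + norm (snd z)"
      using norm_Pair_le[of "fst z" "snd z"] norm_Pair_le[of "fst (fst z)" "snd (fst z)"] by simp
    ultimately show "norm z \<le> 2 * real CARD('n offdiag) + real CARD('n)" by linarith
  qed
  ultimately have "polytope Q" by (simp add: polytope_eq_bounded_polyhedron)
  then have "polytope (fst ` Q)" by (intro polytope_linear_image linear_fst)
  moreover have "fst ` Q = causal_polytope"
    by (auto simp: Q_def causal_polytope_eq image_iff intro: bexI)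
  ultimately show ?thesis by simp
qed

section \<open>Full dimension\<close>

lemma open_Collect_all:
  fixes A :: "'i :: finite \<Rightarrow> 'a :: topological_space \<Rightarrow> bool"
  assumes "\<And>i. open {z. A i z}"
  shows "open {z. \<forall>i. A i z}"
  using open_INT[of UNIV "\<lambda>i. {z. A i z}"] assms by (simp add: INTER_eq)

lemma aff_dim_causal_polytope:
  "aff_dim (causal_polytope :: 'n :: card2 corr_space set) = int DIM('n corr_space)"
proof -
  \<comment> \<open>In this cube any two entries differ by less than 1/2, which is at most
    \<open>1 - 1/n\<close> as \<open>n \<ge> 2\<close>; hence the uniform order distribution is a
    witness throughout.\<close>
  define U :: "'n corr_space set" where
    "U = {x. \<forall>e. 1 / 4 < fst x $ e \<and> fst x $ e < 3 / 4 \<and> 1 / 4 < snd x $ e \<and> snd x $ e < 3 / 4}"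
  have "open U"
    unfolding U_def
    by (intro open_Collect_all open_Collect_conj open_Collect_less continuous_intros)
  moreover have "((\<chi> e. 1 / 2), (\<chi> e. 1 / 2)) \<in> U"
    by (simp add: U_def)
  ultimately have U: "aff_dim U = int DIM('n corr_space)"
    by (intro aff_dim_open) auto
  have "U \<subseteq> causal_polytope"
  proof
    fix x assume x: "x \<in> U"
    have n: "1 / real CARD('n) \<le> 1 / 2"
      using two_le_card[where 'a = 'n] by (simp add: divide_simps)
    have b: "\<bar>fst x $ e - snd x $ e\<bar> \<le> 1 - 1 / real CARD('n)" "0 \<le> fst x $ e" "fst x $ e \<le> 1"
      "0 \<le> snd x $ e" "snd x $ e \<le> 1" for e
    proof -
      have "1 / 4 < fst x $ e" "fst x $ e < 3 / 4" "1 / 4 < snd x $ e" "snd x $ e < 3 / 4"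
        using x by (auto simp: U_def)
      then show "\<bar>fst x $ e - snd x $ e\<bar> \<le> 1 - 1 / real CARD('n)" "0 \<le> fst x $ e" "fst x $ e \<le> 1"
        "0 \<le> snd x $ e" "snd x $ e \<le> 1"
        using n by linarith+
    qed
    then have "order_witness x (\<chi> i. 1 / real CARD('n))"
      by (simp add: order_witness_def)
    then show "x \<in> causal_polytope" by (rule order_witness_in_causal_polytope)
  qed
  then show ?thesis
    using aff_dim_subset[of U causal_polytope] U
      aff_dim_le_DIM[of "causal_polytope :: 'n corr_space set"]
    by simp
qed

section \<open>The kefalopoda inequality\<close>

definition arc_into :: "('n \<Rightarrow> 'n) \<Rightarrow> 'n \<Rightarrow> 'n :: card2 offdiag" where
  "arc_into f i = Abs_offdiag (f i, i)"

definition arc_gap :: "('n \<Rightarrow> 'n) \<Rightarrow> 'n :: card2 corr_space \<Rightarrow> 'n \<Rightarrow> real" where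
  "arc_gap f x i = fst x $ arc_into f i - snd x $ arc_into f i"

lemma win_prob_kefalopoda:
  fixes f :: "'n :: card2 \<Rightarrow> 'n"
  assumes "\<And>i. f i \<noteq> i"
  shows "win_prob (kefalopoda f) P =
    1 / 2 + 1 / (2 * real CARD('n)) * (\<Sum>i\<in>UNIV. arc_gap f (corr_vec P) i)"
proof -
  \<comment> \<open>Arcs are indexed by their receivers, so there are exactly \<open>n\<close> of
    them.\<close>
  have inj: "inj (\<lambda>i. (f i, i))" by (auto simp: inj_def)
  have arcs: "parcs (kefalopoda f) = range (\<lambda>i. (f i, i))"
    by (auto simp: kefalopoda_def)
  have "win_prob (kefalopoda f) P =
      1 / (2 * real CARD('n)) * (\<Sum>i\<in>UNIV. pmf (P (f i) i 0) 0 + pmf (P (f i) i 1) 1)"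
    unfolding win_prob_def arcs by (simp add: card_image[OF inj] sum.reindex[OF inj])
  also have "(\<Sum>i\<in>UNIV. pmf (P (f i) i 0) 0 + pmf (P (f i) i 1) 1) =
      (\<Sum>i\<in>UNIV. 1 + arc_gap f (corr_vec P) i)"
  proof (rule sum.cong)
    fix i
    show "pmf (P (f i) i 0) 0 + pmf (P (f i) i 1) 1 = 1 + arc_gap f (corr_vec P) i"
      using pmf_bit_sum[of "P (f i) i 1"] assms[of i]
      by (simp add: arc_gap_def corr_vec_def arc_into_def sender_receiver_Abs)
  qed simp
  finally show ?thesis by (simp add: sum.distrib field_simps)
qed

lemma sum_arc_gap_le:
  fixes f :: "'n :: card2 \<Rightarrow> 'n"
  assumes f: "\<And>i. f i \<noteq> i" and x: "x \<in> causal_polytope"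
  shows "(\<Sum>i\<in>UNIV. arc_gap f x i) \<le> real CARD('n) - 1"
proof -
  obtain q where q: "order_witness x q"
    using x by (auto simp: causal_polytope_eq)
  have "arc_gap f x i \<le> 1 - q $ i" for i
    using q f[of i] sender_receiver_Abs(2)[of "f i" i]
    unfolding order_witness_def arc_gap_def arc_into_def by (metis abs_le_D1)
  then have "(\<Sum>i\<in>UNIV. arc_gap f x i) \<le> (\<Sum>i\<in>UNIV. 1 - q $ i)"
    by (intro sum_mono)
  also have "\<dots> = real CARD('n) - 1"
    using q by (simp add: sum_subtractf order_witness_def)
  finally show ?thesis .
qed

section \<open>The face of equality and its dimension\<close>

definition gap_normal :: "('n \<Rightarrow> 'n) \<Rightarrow> 'n :: card2 corr_space" where
  "gap_normal f = (\<Sum>i\<in>UNIV. (axis (arc_into f i) 1, - axis (arc_into f i) 1))"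

lemma inner_gap_normal: "gap_normal f \<bullet> x = (\<Sum>i\<in>UNIV. arc_gap f x i)"
  by (cases x) (simp add: gap_normal_def inner_sum_left arc_gap_def inner_axis')

lemma aff_dim_causal_face:
  fixes f :: "'n :: card2 \<Rightarrow> 'n"
  assumes f: "\<And>i. f i \<noteq> i"
  shows "aff_dim (causal_polytope \<inter> {x. gap_normal f \<bullet> x = real CARD('n) - 1}) =
    int DIM('n corr_space) - 1"
proof -
  define H where "H = {x. gap_normal f \<bullet> x = real CARD('n) - 1}"
  \<comment> \<open>Strict forms of the constraints for \<open>q\<close> at \<open>i\<close> equal
    to \<open>1 - arc_gap f x i\<close>. On a kefalopoda arc the bound compares the gap with its own
    absolute value, which can never be strict, so there it is replaced by positivity of the
    gap.\<close>
  define U :: "'n corr_space set" where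
    "U = {x. \<forall>e. 0 < fst x $ e \<and> fst x $ e < 1 \<and> 0 < snd x $ e \<and> snd x $ e < 1 \<and>
      (if e = arc_into f (receiver e) then snd x $ e < fst x $ e
       else \<bar>fst x $ e - snd x $ e\<bar> < arc_gap f x (receiver e))}"
  have n: "real CARD('n) \<ge> 2"
    using two_le_card[where 'a = 'n] by simp
  have rec: "receiver (arc_into f i) = i" for i
    using f[of i] by (simp add: arc_into_def sender_receiver_Abs)
  have "open {x :: 'n corr_space. if e = arc_into f (receiver e) then snd x $ e < fst x $ e
       else \<bar>fst x $ e - snd x $ e\<bar> < arc_gap f x (receiver e)}" for e
    unfolding arc_gap_def
    by (cases "e = arc_into f (receiver e)"; simp only: if_True if_False simp_thms)
      (intro open_Collect_less continuous_intros)+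
  then have "open U"
    unfolding U_def
    by (intro open_Collect_all open_Collect_conj open_Collect_less continuous_intros)
  \<comment> \<open>The point belonging to the uniform order distribution: each of the
    \<open>n\<close> arcs has gap \<open>1 - 1/n\<close>, giving total \<open>n - 1\<close>, and
    every other pair has difference 0.\<close>
  define z :: "'n corr_space" where
    "z = ((\<chi> e. if e = arc_into f (receiver e) then 1 - 1 / (2 * real CARD('n)) else 1 / 2),
          (\<chi> e. if e = arc_into f (receiver e) then 1 / (2 * real CARD('n)) else 1 / 2))"
  have gap_z: "arc_gap f z i = 1 - 1 / real CARD('n)" for i
    by (simp add: arc_gap_def z_def rec)
  have "z \<in> U"
    using n by (auto simp: U_def gap_z) (auto simp: z_def field_simps)
  moreover have "z \<in> H"
    using n by (simp add: H_def inner_gap_normal gap_z field_simps)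
  ultimately have "H \<inter> U \<noteq> {}" by blast
  moreover have "convex H" unfolding H_def by (rule convex_hyperplane)
  \<comment> \<open>An open set that meets a convex set cuts out a part of the same
    dimension.\<close>
  ultimately have dim: "aff_dim (H \<inter> U) = aff_dim H"
    using \<open>open U\<close> by (intro aff_dim_convex_Int_open) auto
  have sub: "H \<inter> U \<subseteq> causal_polytope \<inter> H"
  proof
    fix x assume x: "x \<in> H \<inter> U"
    have b: "0 \<le> fst x $ e" "fst x $ e \<le> 1" "0 \<le> snd x $ e" "snd x $ e \<le> 1" for e
      using x by (auto simp: U_def less_imp_le)
    have "0 \<le> 1 - arc_gap f x i" for i
      using b(2)[of "arc_into f i"] b(3)[of "arc_into f i"] by (simp add: arc_gap_def)
    \<comment> \<open>Normalisation of the witness is exactly the equation of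
      \<open>H\<close>.\<close>
    moreover have "(\<Sum>i\<in>UNIV. 1 - arc_gap f x i) = 1"
      using x by (simp add: H_def inner_gap_normal sum_subtractf)
    moreover have "\<bar>fst x $ e - snd x $ e\<bar> \<le> arc_gap f x (receiver e)" for e
    proof (cases "e = arc_into f (receiver e)")
      case True
      then have "arc_gap f x (receiver e) = fst x $ e - snd x $ e" "snd x $ e < fst x $ e"
        using x by (auto simp: arc_gap_def U_def)
      then show ?thesis by simp
    next
      case False
      then show ?thesis using x by (auto simp: U_def less_imp_le)
    qed
    ultimately have "order_witness x (\<chi> i. 1 - arc_gap f x i)"
      using b by (simp add: order_witness_def)
    then show "x \<in> causal_polytope \<inter> H"
      using x order_witness_in_causal_polytope by blast
  qed
  have "gap_normal f \<noteq> 0"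
    using \<open>z \<in> H\<close> n by (auto simp: H_def)
  then have "aff_dim H = int (DIM('n corr_space) - 1)"
    unfolding H_def by (rule aff_dim_hyperplane)
  also have "\<dots> = int DIM('n corr_space) - 1"
    using DIM_positive[where 'a = "'n corr_space"] by linarith
  finally have "aff_dim H = int DIM('n corr_space) - 1" .
  then show ?thesis
    using dim aff_dim_subset[OF sub] aff_dim_subset[of "causal_polytope \<inter> H" H]
    unfolding H_def by simp
qed

theorem corollary2:
  fixes f :: "'n :: card2 \<Rightarrow> 'n"
  assumes "\<And>i. f i \<noteq> i"
  shows "(\<forall>P :: 'n correlation. definite_causal_order P \<longrightarrow>
            win_prob (kefalopoda f) P \<le> 1 - 1 / (2 * real CARD('n))) \<and>
         (\<exists>(v :: 'n corr_space) (c :: real).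
            (\<forall>P :: 'n correlation.
               v \<bullet> corr_vec P - c = win_prob (kefalopoda f) P - (1 - 1 / (2 * real CARD('n)))) \<and>
            facet_defining v c causal_polytope)"
proof -
  \<comment> \<open>The factor \<open>k\<close> is the weight of one arc and one bit in the game.
    With it, \<open>v \<bullet> corr_vec P - c\<close> equals the winning probability minus its
    bound exactly, while the hyperplane stays the same.\<close>
  define k where "k = 1 / (2 * real CARD('n))"
  define v where "v = k *\<^sub>R gap_normal f"
  define c where "c = k * (real CARD('n) - 1)"
  have k: "k > 0" by (simp add: k_def)
  have kn: "k * real CARD('n) = 1 / 2" by (simp add: k_def)
  have le: "v \<bullet> x \<le> c" if "x \<in> causal_polytope" for x
    using sum_arc_gap_le[OF assms that] k by (simp add: v_def c_def inner_gap_normal)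
  have win: "v \<bullet> corr_vec P - c = win_prob (kefalopoda f) P - (1 - k)" for P
    using kn by (simp add: win_prob_kefalopoda[OF assms] v_def c_def inner_gap_normal
        right_diff_distrib flip: k_def)
  have "{x. v \<bullet> x = c} = {x. gap_normal f \<bullet> x = real CARD('n) - 1}"
    using k by (simp add: v_def c_def)
  then have "facet_defining v c causal_polytope"
    unfolding facet_defining_def
    using polytope_causal_polytope aff_dim_causal_polytope le aff_dim_causal_face[OF assms] by simp
  moreover have "win_prob (kefalopoda f) P \<le> 1 - k" if "definite_causal_order P" for P
  proof -
    have "corr_vec P \<in> causal_polytope"
      using that by (simp add: causal_polytope_def)
    then show ?thesis using le win[of P] by fastforce
  qed
  ultimately show ?thesis
    using win unfolding k_def by blast
qed

end
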